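(* For any constant $\varepsilon>0$ there exists $n_0$ such that for every randomized comparison-based algorithm $\mathcal{A}$ that finds the minimum and every $n>n_0$, there exists an input of size $n$ such that with probability at least $n^{-\varepsilon}$, $\mathcal{A}$ performs at least $\frac12\log_2\log_2 n$ comparisons involving the minimum.
   Context: Elements come from a totally ordered set and are accessed only through comparisons. *)

theory Defs
  imports "HOL-Probability.Probability"
begin

text \<open>
  The \<open>n\<close> input elements are named by the indices \<open>0, \<dots>, n - 1\<close>, and an input of size \<open>n\<close> is a
  total order on them. The elements are thus pairwise distinct, so that ``the minimum'' is a
  single element. \<^const>\<open>linear_order_on\<close> also forces the relation to be contained in
  \<open>{..<n} \<times> {..<n}\<close>, hence queries about indices outside the input are always answered
  negatively and carry no information.
\<close>

definition is_input :: "nat \<Rightarrow> nat rel \<Rightarrow> bool" where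
  "is_input n r \<longleftrightarrow> linear_order_on {..<n} r"

definition is_minimum :: "nat \<Rightarrow> nat rel \<Rightarrow> nat \<Rightarrow> bool" where
  "is_minimum n r m \<longleftrightarrow> m < n \<and> (\<forall>j<n. (m, j) \<in> r)"

datatype action = Compare nat nat | Return nat

text \<open>
  A deterministic comparison-based algorithm determines its next action from the input size and
  the outcomes of all comparisons made so far (earliest first). For each \<open>n\<close> this is a binary
  decision tree, possibly with infinite branches; there is no bound on memory or on computation.
\<close>

type_synonym det_algorithm = "nat \<Rightarrow> bool list \<Rightarrow> action"

primrec outcomes :: "det_algorithm \<Rightarrow> nat \<Rightarrow> nat rel \<Rightarrow> nat \<Rightarrow> bool list" where
  "outcomes d n r 0 = []"
| "outcomes d n r (Suc t) =
    (case d n (outcomes d n r t) of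
       Compare i j \<Rightarrow> outcomes d n r t @ [(i, j) \<in> r]
     | Return k \<Rightarrow> outcomes d n r t)"

definition action_at :: "det_algorithm \<Rightarrow> nat \<Rightarrow> nat rel \<Rightarrow> nat \<Rightarrow> action" where
  "action_at d n r t = d n (outcomes d n r t)"

definition outputs :: "det_algorithm \<Rightarrow> nat \<Rightarrow> nat rel \<Rightarrow> nat \<Rightarrow> bool" where
  "outputs d n r k \<longleftrightarrow> (\<exists>t. action_at d n r t = Return k)"

text \<open>
  Only comparisons of \<open>m\<close> with a different input element are counted; repeated comparisons are
  counted as often as they are performed.
\<close>

definition involves :: "nat \<Rightarrow> nat \<Rightarrow> action \<Rightarrow> bool" where
  "involves n m a \<longleftrightarrow> (\<exists>j<n. j \<noteq> m \<and> (a = Compare m j \<or> a = Compare j m))"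

definition comparisons_within :: "det_algorithm \<Rightarrow> nat \<Rightarrow> nat rel \<Rightarrow> nat \<Rightarrow> nat \<Rightarrow> nat" where
  "comparisons_within d n r m T = card {t. t < T \<and> involves n m (action_at d n r t)}"

text \<open>
  The prefix length \<open>T\<close> is quantified because a run may be infinite, in which case the total
  number of comparisons may be infinite as well.
\<close>

definition performs_at_least :: "det_algorithm \<Rightarrow> nat \<Rightarrow> nat rel \<Rightarrow> nat \<Rightarrow> real \<Rightarrow> bool" where
  "performs_at_least d n r m b \<longleftrightarrow> (\<exists>T. b \<le> real (comparisons_within d n r m T))"

text \<open>
  A randomized algorithm is a probability distribution over deterministic ones, i.e. over what
  remains once all random choices are fixed. The \<open>\<sigma>\<close>-algebra is the coarsest one for which every
  individual action \<open>d n h\<close> is a (discrete) random variable.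
\<close>

definition det_algorithm_space :: "det_algorithm measure" where
  "det_algorithm_space = (\<Pi>\<^sub>M n\<in>UNIV. \<Pi>\<^sub>M h\<in>UNIV. count_space UNIV)"

definition randomized_algorithm :: "det_algorithm measure \<Rightarrow> bool" where
  "randomized_algorithm A \<longleftrightarrow> prob_space A \<and> sets A = sets det_algorithm_space"

definition finds_minimum :: "det_algorithm measure \<Rightarrow> bool" where
  "finds_minimum A \<longleftrightarrow>
    (\<forall>n r. 0 < n \<longrightarrow> is_input n r \<longrightarrow> (AE d in A. \<exists>k. outputs d n r k \<and> is_minimum n r k))"

end

theory Submission
  imports Defs "HOL-Real_Asymp.Real_Asymp"
begin

text \<open>
  The admissible failure probability is so large that a deterministic worst-case bound suffices.
  Let only the \<open>N \<approx> sqrt (log 2 n)\<close> first elements be ordered arbitrarily and put all others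
  above them in a fixed order. On one of these \<open>N!\<close> inputs a correct decision tree has to compare
  the minimum at least \<open>log 2 N\<close> times: an adversary lets the heavier of two candidates win and
  absorb the weight of the other, so that a candidate's weight at most doubles in each of its
  comparisons, and it must reach \<open>N\<close>. By the union bound, one of the inputs is this bad
  with probability at least \<open>1 / N! \<ge> N powr (- N)\<close>, which exceeds \<open>n powr (- \<epsilon>)\<close> for large \<open>n\<close>.
\<close>

section \<open>Hard inputs as orders given by lists\<close>

fun list_order :: "'a list \<Rightarrow> 'a rel" where
  "list_order [] = {}"
| "list_order (x # xs) = {x} \<times> set (x # xs) \<union> list_order xs"

lemma list_order_subset: "list_order xs \<subseteq> set xs \<times> set xs"
  by (induction xs) auto

lemma list_order_append:
  "list_order (xs @ ys) = list_order xs \<union> set xs \<times> set ys \<union> list_order ys"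
  by (induction xs) auto

lemma list_order_refl: "x \<in> set xs \<Longrightarrow> (x, x) \<in> list_order xs"
  by (induction xs) auto

lemma linear_order_on_list_order:
  "distinct xs \<Longrightarrow> linear_order_on (set xs) (list_order xs)"
proof (induction xs)
  case Nil
  then show ?case by simp
next
  case (Cons x xs)
  let ?r = "list_order xs"
  have sub: "y \<in> set xs \<and> z \<in> set xs" if "(y, z) \<in> ?r" for y z
    using list_order_subset that by fastforce
  have x: "x \<notin> set xs" and lin: "linear_order_on (set xs) ?r" using Cons by auto
  have "trans (list_order (x # xs))"
  proof (rule transI)
    fix u v w assume "(u, v) \<in> list_order (x # xs)" "(v, w) \<in> list_order (x # xs)"
    moreover have "(u, w) \<in> ?r" if "(u, v) \<in> ?r" "(v, w) \<in> ?r"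
      using lin that by (meson order_on_defs transD)
    ultimately show "(u, w) \<in> list_order (x # xs)" using x sub by auto
  qed
  moreover have "antisym (list_order (x # xs))"
  proof (rule antisymI)
    fix u v assume "(u, v) \<in> list_order (x # xs)" "(v, u) \<in> list_order (x # xs)"
    moreover have "u = v" if "(u, v) \<in> ?r" "(v, u) \<in> ?r"
      using lin that by (meson order_on_defs antisymD)
    ultimately show "u = v" using x sub by auto
  qed
  moreover have "total_on (set (x # xs)) (list_order (x # xs))"
    using lin by (auto simp: order_on_defs total_on_def)
  moreover have "refl_on (set (x # xs)) (list_order (x # xs))"
    using list_order_refl[of _ "x # xs"] by (auto simp: refl_on_def)
  ultimately show ?case
    using list_order_subset[of "x # xs"] unfolding order_on_defs by blast
qed

definition hard_order :: "nat \<Rightarrow> nat \<Rightarrow> nat list \<Rightarrow> nat rel" where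
  "hard_order n N xs = list_order (xs @ [N..<n])"

lemma is_input_hard_order:
  assumes "xs \<in> permutations_of_set {..<N}" "N \<le> n"
  shows "is_input n (hard_order n N xs)"
proof -
  have xs: "set xs = {..<N}" "distinct xs"
    using assms(1) by (simp_all add: permutations_of_set_def)
  have zs: "distinct (xs @ [N..<n])" "set (xs @ [N..<n]) = {..<n}"
    using xs ivl_disj_un_one(2)[OF assms(2)] ivl_disj_int_one(2)[of N n] by simp_all
  show ?thesis
    using linear_order_on_list_order[OF zs(1)]
    unfolding is_input_def hard_order_def zs(2) .
qed

lemma is_minimum_hard_order:
  assumes "xs \<in> permutations_of_set {..<N}" "0 < N" "N \<le> n"
  shows "is_minimum n (hard_order n N xs) (hd xs)"
proof -
  have xs: "set xs = {..<N}"
    using assms(1) by (simp add: permutations_of_set_def)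
  then have "0 \<in> set xs" using assms(2) by simp
  then obtain y ys where Cons: "xs = y # ys" by (cases xs) auto
  have "y \<in> {..<N}" unfolding xs[symmetric] Cons by simp
  have "(y, j) \<in> hard_order n N xs" if "j < n" for j
  proof -
    have "j \<in> set xs \<union> set [N..<n]" unfolding xs using that by (simp, linarith)
    then show ?thesis using Cons by (auto simp: hard_order_def)
  qed
  with \<open>y \<in> {..<N}\<close> show ?thesis
    using Cons assms(3) by (simp add: is_minimum_def)
qed

lemma is_minimum_unique:
  assumes "is_input n r" "is_minimum n r k" "is_minimum n r m"
  shows "k = m"
proof (rule antisymD[of r])
  show "antisym r" using assms(1) by (simp add: is_input_def order_on_defs)
  show "(k, m) \<in> r" "(m, k) \<in> r" using assms(2,3) by (simp_all add: is_minimum_def)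
qed

section \<open>Runs of a decision tree and the adversary\<close>

lemma action_at_Return_mono:
  assumes "action_at d n r t = Return k" "t \<le> t'"
  shows "action_at d n r t' = Return k"
  using assms(2,1)
  by (induction t' rule: dec_induct) (auto simp: action_at_def)

lemma comparisons_within_0 [simp]: "comparisons_within d n r m 0 = 0"
  by (simp add: comparisons_within_def)

lemma comparisons_within_Suc:
  "comparisons_within d n r m (Suc T) =
    comparisons_within d n r m T + of_bool (involves n m (action_at d n r T))"
proof -
  have "{t. t < Suc T \<and> involves n m (action_at d n r t)} =
      {t. t < T \<and> involves n m (action_at d n r t)} \<union>
      (if involves n m (action_at d n r T) then {T} else {})"
    by (auto simp: less_Suc_eq)
  then show ?thesis
    by (auto simp: comparisons_within_def)
qed

text \<open>
  The adversary answers as if each eliminated element had been put at the front of the list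
  \<open>M\<close>; the elements of \<open>S\<close> may still be the minimum, and \<open>w x\<close> counts the elements that \<open>x\<close> has
  absorbed.
\<close>

definition adversary_state ::
    "det_algorithm \<Rightarrow> nat \<Rightarrow> nat \<Rightarrow> nat \<Rightarrow> nat set \<Rightarrow> nat list \<Rightarrow> (nat \<Rightarrow> nat) \<Rightarrow> (nat \<Rightarrow> nat)
      \<Rightarrow> bool list \<Rightarrow> bool" where
  "adversary_state d n N t S M w c h \<longleftrightarrow>
    distinct M \<and> S \<inter> set M = {} \<and> S \<union> set M = {..<N} \<and> S \<noteq> {} \<and>
    sum w S = N \<and> (\<forall>x\<in>S. w x \<le> 2 ^ c x) \<and>
    (\<forall>xs\<in>permutations_of_set S.
      outcomes d n (hard_order n N (xs @ M)) t = h \<and>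
      (\<forall>x\<in>S. comparisons_within d n (hard_order n N (xs @ M)) x t = c x))"

text \<open>Serves every action whose effect is the same for all orders of the candidates, including
  \<open>Return\<close>. A query may still involve a candidate; raising its count only relaxes the
  bound \<open>w x \<le> 2 ^ c x\<close>.\<close>

lemma adversary_step_keep:
  assumes st: "adversary_state d n N t S M w c h"
    and same: "\<And>xs. xs \<in> permutations_of_set S \<Longrightarrow>
      outcomes d n (hard_order n N (xs @ M)) (Suc t) = h'"
  shows "adversary_state d n N (Suc t) S M w (\<lambda>x. c x + of_bool (involves n x (d n h))) h'"
proof -
  have "w x \<le> 2 ^ (c x + of_bool (involves n x (d n h)))" if "x \<in> S" for x
  proof -
    have "w x \<le> 2 ^ c x" using st that by (simp add: adversary_state_def)
    also have "\<dots> \<le> 2 ^ (c x + of_bool (involves n x (d n h)))" by (rule power_increasing) auto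
    finally show ?thesis .
  qed
  then show ?thesis
    using st same unfolding adversary_state_def
    by (auto simp: comparisons_within_Suc action_at_def simp del: outcomes.simps)
qed

text \<open>Eliminating \<open>b\<close> places it above all remaining candidates and below all of
  \<open>M\<close>. An order of \<open>S - {b}\<close> followed by \<open>b\<close> is an order of
  \<open>S\<close>, so the earlier history and counts persist. The comparison involves
  \<open>a\<close>, which pays for its gain in weight:
  \<open>w a + w b \<le> 2 * w a \<le> 2 ^ (c a + 1)\<close>. The flag \<open>v\<close> covers both
  ways of posing the query.\<close>

lemma adversary_step_eliminate:
  assumes st: "adversary_state d n N t S M w c h" and "N \<le> n"
    and ab: "a \<in> S" "b \<in> S" "a \<noteq> b" "w b \<le> w a"
    and act: "d n h = Compare a b \<and> v \<or> d n h = Compare b a \<and> \<not> v"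
  shows "adversary_state d n N (Suc t) (S - {b}) (b # M) (w(a := w a + w b))
    (\<lambda>x. c x + of_bool (involves n x (d n h))) (h @ [v])"
proof -
  let ?c = "\<lambda>x. c x + of_bool (involves n x (d n h))"
  let ?w = "w(a := w a + w b)"
  have SN: "S \<subseteq> {..<N}" and disj: "S \<inter> set M = {}"
    using st by (auto simp: adversary_state_def)
  have fin: "finite S" using SN by (rule finite_subset) simp
  have inv: "involves n a (d n h)"
    using act ab SN \<open>N \<le> n\<close> unfolding involves_def by fastforce
  have wle: "?w x \<le> 2 ^ ?c x" if "x \<in> S - {b}" for x
  proof -
    have le: "w x \<le> 2 ^ c x" using st that by (simp add: adversary_state_def)
    show ?thesis
    proof (cases "x = a")
      case True
      then show ?thesis using le inv ab by simp
    next
      case False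
      have "w x \<le> 2 ^ ?c x"
        using le by (rule order_trans) (rule power_increasing, auto)
      then show ?thesis using False by simp
    qed
  qed
  have sum: "sum ?w (S - {b}) = N"
  proof -
    have "sum w S = w b + (w a + sum w (S - {b} - {a}))"
      using fin ab by (simp add: sum.remove[of S b] sum.remove[of "S - {b}" a])
    moreover have "sum ?w (S - {b}) = (w a + w b) + sum w (S - {b} - {a})"
      using fin ab by (simp add: sum.remove[of "S - {b}" a])
    ultimately show ?thesis using st by (simp add: adversary_state_def)
  qed
  have perm: "xs @ [b] \<in> permutations_of_set S" if "xs \<in> permutations_of_set (S - {b})" for xs
    using that ab by (auto simp: permutations_of_set_def)
  have out: "outcomes d n (hard_order n N (xs @ b # M)) t = h \<and>
      (\<forall>x\<in>S. comparisons_within d n (hard_order n N (xs @ b # M)) x t = c x)"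
    if "xs \<in> permutations_of_set (S - {b})" for xs
    using st perm[OF that] unfolding adversary_state_def
    by (metis append.assoc append_Cons append_Nil)
  have answer: "(a, b) \<in> hard_order n N (xs @ b # M) \<and> (b, a) \<notin> hard_order n N (xs @ b # M)"
    if "xs \<in> permutations_of_set (S - {b})" for xs
  proof -
    have xs: "set xs = S - {b}" using that by (simp add: permutations_of_set_def)
    have "a \<notin> set M" "a < N" "b < N" using ab disj SN by auto
    moreover have "(b, a) \<notin> list_order xs" "(b, a) \<notin> list_order (M @ [N..<n])"
      using calculation list_order_subset[of xs] list_order_subset[of "M @ [N..<n]"] xs by auto
    ultimately show ?thesis
      using xs ab by (auto simp: hard_order_def list_order_append[of xs])
  qed
  have step: "outcomes d n (hard_order n N (xs @ b # M)) (Suc t) = h @ [v]"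
    if "xs \<in> permutations_of_set (S - {b})" for xs
    using out[OF that] answer[OF that] act by auto
  show ?thesis
    unfolding adversary_state_def
  proof (intro conjI ballI)
    show "distinct (b # M)" "(S - {b}) \<inter> set (b # M) = {}" "S - {b} \<union> set (b # M) = {..<N}"
      using st ab by (auto simp: adversary_state_def)
    show "S - {b} \<noteq> {}" using ab by auto
    show "sum ?w (S - {b}) = N" by (rule sum)
    show "?w x \<le> 2 ^ ?c x" if "x \<in> S - {b}" for x by (rule wle[OF that])
    fix xs assume xs: "xs \<in> permutations_of_set (S - {b})"
    show "outcomes d n (hard_order n N (xs @ b # M)) (Suc t) = h @ [v]" by (rule step[OF xs])
    fix x assume "x \<in> S - {b}"
    then show "comparisons_within d n (hard_order n N (xs @ b # M)) x (Suc t) = ?c x"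
      using out[OF xs] by (simp add: comparisons_within_Suc action_at_def)
  qed
qed

lemma adversary_state_exists:
  assumes "0 < N" "N \<le> n"
  shows "\<exists>S M w c h. adversary_state d n N t S M w c h"
proof (induction t)
  case 0
  \<comment> \<open>Every element starts as a candidate of weight 1 = 2 ^ 0, so the total weight is
    \<open>N\<close>.\<close>
  have "adversary_state d n N 0 {..<N} [] (\<lambda>_. 1) (\<lambda>_. 0) []"
    using assms by (auto simp: adversary_state_def)
  then show ?case by blast
next
  case (Suc t)
  then obtain S M w c h where st: "adversary_state d n N t S M w c h" by blast
  show ?case
  proof (cases "d n h")
    case (Return k)
    have "outcomes d n (hard_order n N (xs @ M)) (Suc t) = h"
      if "xs \<in> permutations_of_set S" for xs
      using st that Return by (auto simp: adversary_state_def)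
    from adversary_step_keep[OF st this] show ?thesis by blast
  next
    case (Compare i j)
    show ?thesis
    proof (cases "i \<in> S \<and> j \<in> S \<and> i \<noteq> j")
      case True
      show ?thesis
      proof (cases "w j \<le> w i")
        case le: True
        then show ?thesis
          using adversary_step_eliminate[OF st assms(2), of i j True] True Compare by blast
      next
        case False
        then show ?thesis
          using adversary_step_eliminate[OF st assms(2), of j i False] True Compare
          by (metis nat_le_linear)
      qed
    next
      case False
      \<comment> \<open>Unless two distinct candidates are compared, the answer does not depend on
        the order of \<open>S\<close>: candidates lie below everything in
        \<open>M @ [N..<n]\<close>, whose order is fixed, \<open>i = j\<close> is answered by
        reflexivity, and an index outside the input yields \<open>False\<close>.\<close>
      define v where "v \<longleftrightarrow> i = j \<and> i \<in> S \<or> (i, j) \<in> S \<times> set (M @ [N..<n]) \<union> list_order (M @ [N..<n])"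
      have "outcomes d n (hard_order n N (xs @ M)) (Suc t) = h @ [v]"
        if "xs \<in> permutations_of_set S" for xs
      proof -
        have xs: "set xs = S" using that by (simp add: permutations_of_set_def)
        have "(i, j) \<in> hard_order n N (xs @ M) \<longleftrightarrow> v"
          using xs False list_order_subset[of xs] list_order_refl[of i xs]
          unfolding hard_order_def v_def append_assoc list_order_append[of xs] by auto
        then show ?thesis
          using st that Compare by (auto simp: adversary_state_def)
      qed
      from adversary_step_keep[OF st this] show ?thesis by blast
    qed
  qed
qed

text \<open>Once the runs on all these inputs have stopped, the orders compatible with the
  adversary's state share one history and hence one answer. Each candidate is the minimum of one of
  these orders, so a single candidate is left, and it carries the whole weight
  \<open>N\<close>.\<close>

lemma deterministic_lower_bound:
  assumes N: "0 < N" "N \<le> n"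
    and correct: "\<And>xs. xs \<in> permutations_of_set {..<N} \<Longrightarrow>
      \<exists>k. outputs d n (hard_order n N xs) k \<and> is_minimum n (hard_order n N xs) k"
  shows "\<exists>xs\<in>permutations_of_set {..<N}.
    \<exists>T. N \<le> 2 ^ comparisons_within d n (hard_order n N xs) (hd xs) T"
proof -
  have "\<exists>t. action_at d n (hard_order n N xs) t = Return (hd xs)"
    if "xs \<in> permutations_of_set {..<N}" for xs
    using correct[OF that] is_minimum_hard_order[OF that N] is_input_hard_order[OF that N(2)]
      is_minimum_unique unfolding outputs_def by metis
  then obtain \<tau> where \<tau>: "action_at d n (hard_order n N xs) (\<tau> xs) = Return (hd xs)"
    if "xs \<in> permutations_of_set {..<N}" for xs by metis
  \<comment> \<open>There are finitely many inputs and a returned action persists, so one time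
    serves all of them.\<close>
  define T where "T = Max (\<tau> ` permutations_of_set {..<N})"
  have ret: "action_at d n (hard_order n N xs) T = Return (hd xs)"
    if "xs \<in> permutations_of_set {..<N}" for xs
    using \<tau>[OF that] by (rule action_at_Return_mono) (auto simp: T_def that)
  obtain S M w c h where st: "adversary_state d n N T S M w c h"
    using adversary_state_exists[OF N] by blast
  have perm: "xs @ M \<in> permutations_of_set {..<N}" if "xs \<in> permutations_of_set S" for xs
    using st that by (auto simp: adversary_state_def permutations_of_set_def)
  have fin: "finite S"
    using st by (metis adversary_state_def finite_Un finite_lessThan)
  have first: "d n h = Return x" if "x \<in> S" for x
  proof -
    obtain ys where ys: "set ys = S - {x}" "distinct ys"
      using fin finite_distinct_list[of "S - {x}"] by blast
    then have p: "x # ys \<in> permutations_of_set S"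
      using that by (auto simp: permutations_of_set_def)
    show ?thesis
      using ret[OF perm[OF p]] st p by (auto simp: adversary_state_def action_at_def)
  qed
  obtain m where "m \<in> S" using st by (auto simp: adversary_state_def)
  then have "x = m" if "x \<in> S" for x using first[OF that] first[of m] by simp
  with \<open>m \<in> S\<close> have S: "S = {m}" by blast
  then have m: "[m] \<in> permutations_of_set S" by (simp add: permutations_of_set_def)
  have "w m = N" "w m \<le> 2 ^ c m"
    "comparisons_within d n (hard_order n N ([m] @ M)) m T = c m"
    using st m unfolding adversary_state_def S by auto
  then show ?thesis
    using perm[OF m] by (intro bexI[of _ "[m] @ M"] exI[of _ T]) auto
qed

section \<open>Measurability of runs\<close>

instance action :: countable
  by countable_datatype

lemma measurable_action:
  assumes "sets A = sets det_algorithm_space"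
  shows "(\<lambda>d. d n h) \<in> measurable A (count_space UNIV)"
proof -
  have "(\<lambda>d. d n h) \<in> measurable det_algorithm_space (count_space UNIV)"
    unfolding det_algorithm_space_def
    by (rule measurable_compose[where f = "\<lambda>d. d n" and g = "\<lambda>e. e h"])
      (rule measurable_component_singleton, simp)+
  then show ?thesis using measurable_cong_sets[OF assms refl] by blast
qed

text \<open>The next action is read off at a history that itself depends on \<open>d\<close>.
  Histories range over a countable type, so measurability of \<open>d n h\<close> for each fixed
  \<open>h\<close> is enough.\<close>

lemma measurable_outcomes:
  assumes "sets A = sets det_algorithm_space"
  shows "(\<lambda>d. outcomes d n r t) \<in> measurable A (count_space UNIV)"
proof (induction t)
  case 0
  then show ?case by simp
next
  case (Suc t)
  note [measurable] = Suc measurable_action[OF assms]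
  have [measurable]: "(\<lambda>d. d n (outcomes d n r t)) \<in> measurable A (count_space UNIV)"
    by (rule measurable_compose_countable[where f = "\<lambda>h d. d n h"]) measurable
  \<comment> \<open>Writing the recursion as a fixed function of the pair of action and history
    reduces it to two measurable maps into countable types.\<close>
  have "(\<lambda>d. (\<lambda>(a, h). case a of Compare i j \<Rightarrow> h @ [(i, j) \<in> r] | Return k \<Rightarrow> h)
      (d n (outcomes d n r t), outcomes d n r t)) \<in> measurable A (count_space UNIV)"
    by measurable
  then show ?case by simp
qed

lemma measurable_action_at:
  assumes "sets A = sets det_algorithm_space"
  shows "(\<lambda>d. action_at d n r t) \<in> measurable A (count_space UNIV)"
proof -
  note [measurable] = measurable_outcomes[OF assms] measurable_action[OF assms]
  show ?thesis unfolding action_at_def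
    by (rule measurable_compose_countable[where f = "\<lambda>h d. d n h"]) measurable
qed

text \<open>The existential over \<open>T\<close> is a countable union, and each count is a finite
  sum of indicators of measurable events.\<close>

lemma sets_performs_at_least:
  assumes "sets A = sets det_algorithm_space"
  shows "{d \<in> space A. performs_at_least d n r m b} \<in> sets A"
proof -
  note [measurable] = measurable_action_at[OF assms]
  have [measurable]: "(\<lambda>d. comparisons_within d n r m T) \<in> measurable A (count_space UNIV)" for T
  proof (induction T)
    case (Suc T)
    note [measurable] = Suc
    show ?case unfolding comparisons_within_Suc by measurable
  qed simp
  show ?thesis unfolding performs_at_least_def by measurable
qed

section \<open>From deterministic to randomized algorithms\<close>

lemma (in prob_space) ex_prob_ge_inverse_card:
  assumes "finite I" and E: "\<And>i. i \<in> I \<Longrightarrow> E i \<in> events"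
    and ae: "AE x in M. \<exists>i\<in>I. x \<in> E i"
  shows "\<exists>i\<in>I. 1 / real (card I) \<le> prob (E i)"
proof (rule ccontr)
  assume *: "\<not> ?thesis"
  \<comment> \<open>The comparison of sums below is strict only over a nonempty index set; were
    \<open>I\<close> empty, \<open>ae\<close> would say that \<open>False\<close> holds almost
    everywhere.\<close>
  have "I \<noteq> {}" using ae AE_False by auto
  have "(\<Union>i\<in>I. E i) \<in> events" using assms(1) E by auto
  then have "1 = prob (\<Union>i\<in>I. E i)" using ae prob_eq_1 by simp
  also have "\<dots> \<le> (\<Sum>i\<in>I. prob (E i))"
    using assms(1) E by (intro finite_measure_subadditive_finite) auto
  also have "\<dots> < (\<Sum>i\<in>I. 1 / real (card I))"
    using * assms(1) \<open>I \<noteq> {}\<close> by (intro sum_strict_mono) auto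
  also have "\<dots> = 1" using assms(1) \<open>I \<noteq> {}\<close> by simp
  finally show False by simp
qed

lemma randomized_lower_bound:
  assumes A: "randomized_algorithm A" "finds_minimum A" and N: "0 < N" "N \<le> n"
  shows "\<exists>r m. is_input n r \<and> is_minimum n r m \<and>
    1 / fact N \<le> measure A {d \<in> space A. performs_at_least d n r m (log 2 (real N))}"
proof -
  interpret prob_space A using A by (simp add: randomized_algorithm_def)
  let ?P = "permutations_of_set {..<N}"
  let ?E = "\<lambda>xs. {d \<in> space A. performs_at_least d n (hard_order n N xs) (hd xs) (log 2 (real N))}"
  \<comment> \<open>Each input has its own null set of failing algorithms; over finitely many inputs
    these combine into one null set.\<close>
  have "AE d in A. \<forall>xs\<in>?P. \<exists>k. outputs d n (hard_order n N xs) k \<and>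
      is_minimum n (hard_order n N xs) k"
    using A N is_input_hard_order unfolding finds_minimum_def
    by (intro AE_finite_allI) auto
  moreover have "AE d in A. d \<in> space A" by (rule AE_space)
  ultimately have "AE d in A. \<exists>xs\<in>?P. d \<in> ?E xs"
  proof eventually_elim
    case (elim d)
    then obtain xs T where xs: "xs \<in> ?P"
      and le: "N \<le> 2 ^ comparisons_within d n (hard_order n N xs) (hd xs) T"
      using deterministic_lower_bound[OF N, of d] by blast
    have "real N \<le> 2 ^ comparisons_within d n (hard_order n N xs) (hd xs) T"
      using le by (metis of_nat_le_iff of_nat_numeral of_nat_power)
    then have "log 2 (real N) \<le> real (comparisons_within d n (hard_order n N xs) (hd xs) T)"
      using N by (simp add: log_le_iff powr_realpow)
    then show ?case using elim xs by (auto simp: performs_at_least_def)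
  qed
  moreover have "?E xs \<in> events" for xs
    using A by (intro sets_performs_at_least) (simp add: randomized_algorithm_def)
  ultimately obtain xs where "xs \<in> ?P" "1 / real (card ?P) \<le> prob (?E xs)"
    using ex_prob_ge_inverse_card[of ?P ?E] by auto
  then show ?thesis
    using is_input_hard_order[of xs N n] is_minimum_hard_order[of xs N n] N
    by (intro exI[of _ "hard_order n N xs"] exI[of _ "hd xs"]) simp
qed

section \<open>Choice of \<open>N\<close> and asymptotics\<close>

theorem theorem14:
  fixes \<epsilon> :: real
  assumes "\<epsilon> > 0"
  shows "\<exists>n0::nat. \<forall>A. randomized_algorithm A \<longrightarrow> finds_minimum A \<longrightarrow>
    (\<forall>n>n0. \<exists>r m. is_input n r \<and> is_minimum n r m \<and>
      measure A {d \<in> space A. performs_at_least d n r m (1/2 * log 2 (log 2 (real n)))}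
        \<ge> real n powr (- \<epsilon>))"
proof -
  \<comment> \<open>For \<open>N\<close> at most \<open>sqrt (log 2 n) + 1\<close>, this bounds
    \<open>ln (fact N) \<le> N * ln N\<close> by \<open>\<epsilon> * ln n\<close>. It holds for
    large \<open>n\<close> because the left side has order
    \<open>sqrt (ln n) * ln (ln n)\<close>.\<close>
  have "eventually (\<lambda>n. (sqrt (log 2 (real n)) + 1) * ln (sqrt (log 2 (real n)) + 1)
      \<le> \<epsilon> * ln (real n)) sequentially"
    using assms by real_asymp
  moreover have "eventually (\<lambda>n. sqrt (log 2 (real n)) + 1 \<le> real n) sequentially"
    by real_asymp
  ultimately have "eventually (\<lambda>n. 2 \<le> n \<and> sqrt (log 2 (real n)) + 1 \<le> real n \<and>
      (sqrt (log 2 (real n)) + 1) * ln (sqrt (log 2 (real n)) + 1) \<le> \<epsilon> * ln (real n)) sequentially"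
    using eventually_ge_at_top[of 2] by eventually_elim auto
  then obtain n0 where n0: "2 \<le> n \<and> sqrt (log 2 (real n)) + 1 \<le> real n \<and>
      (sqrt (log 2 (real n)) + 1) * ln (sqrt (log 2 (real n)) + 1) \<le> \<epsilon> * ln (real n)"
    if "n0 \<le> n" for n
    by (auto simp: eventually_sequentially)
  show ?thesis
  proof (intro exI[of _ n0] allI impI)
    fix A n
    assume A: "randomized_algorithm A" "finds_minimum A" and "n0 < n"
    \<comment> \<open>The square root is the source of the factor 1/2: \<open>log 2 s\<close> is
      exactly \<open>1/2 * log 2 (log 2 n)\<close>. Rounding \<open>s\<close> up to \<open>N\<close>
      keeps this lower bound and adds at most 1 in the estimate of the factorial.\<close>
    define s where "s = sqrt (log 2 (real n))"
    define N where "N = nat \<lceil>s\<rceil>"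
    have n: "2 \<le> n" "s + 1 \<le> real n" "(s + 1) * ln (s + 1) \<le> \<epsilon> * ln (real n)"
      using n0[of n] \<open>n0 < n\<close> by (auto simp: s_def)
    then have lg: "1 \<le> log 2 (real n)" by simp
    then have s: "1 \<le> s" by (simp add: s_def)
    have N: "s \<le> real N" "real N \<le> s + 1" using s unfolding N_def by linarith+
    have N': "0 < N" "N \<le> n" using N s n by linarith+
    have "(fact N :: real) \<le> real N ^ N"
      using fact_le_power[of N, where 'a = real] by simp
    also have "\<dots> = exp (real N * ln (real N))"
      using N' by (simp add: exp_of_nat_mult)
    also have "real N * ln (real N) \<le> (s + 1) * ln (s + 1)"
      using N N' s by (intro mult_mono) auto
    also note n(3)
    finally have "(fact N :: real) \<le> real n powr \<epsilon>"
      using n(1) by (simp add: powr_def)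
    then have "1 / real n powr \<epsilon> \<le> 1 / fact N"
      using n(1) by (intro divide_left_mono) auto
    then have p: "real n powr (- \<epsilon>) \<le> 1 / fact N"
      by (simp add: powr_minus_divide)
    have "ln s = ln (log 2 (real n)) / 2"
      unfolding s_def using lg by (intro ln_sqrt) linarith
    then have "1/2 * log 2 (log 2 (real n)) = log 2 s"
      by (simp only: log_def[of 2 s] log_def[of 2 "log 2 (real n)"])
    also have "\<dots> \<le> log 2 (real N)" using N s by simp
    finally have b: "1/2 * log 2 (log 2 (real n)) \<le> log 2 (real N)" .
    obtain r m where rm: "is_input n r" "is_minimum n r m"
      and ge: "1 / fact N \<le> measure A {d \<in> space A. performs_at_least d n r m (log 2 (real N))}"
      using randomized_lower_bound[OF A N'] by blast
    interpret prob_space A using A by (simp add: randomized_algorithm_def)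
    have mono: "performs_at_least d n r m (1/2 * log 2 (log 2 (real n)))"
      if "performs_at_least d n r m (log 2 (real N))" for d
      using that order_trans[OF b] unfolding performs_at_least_def by blast
    note ge
    also have "measure A {d \<in> space A. performs_at_least d n r m (log 2 (real N))} \<le>
        measure A {d \<in> space A. performs_at_least d n r m (1/2 * log 2 (log 2 (real n)))}"
      using A(1) mono unfolding randomized_algorithm_def
      by (intro finite_measure_mono sets_performs_at_least) auto
    finally show "\<exists>r m. is_input n r \<and> is_minimum n r m \<and>
        real n powr (- \<epsilon>) \<le>
          measure A {d \<in> space A. performs_at_least d n r m (1/2 * log 2 (log 2 (real n)))}"
      using p rm by (meson order_trans)
  qed
qed

end
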